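(* Let $f:\mathbb{R}^d\to\mathbb{R}$ be $(L,\mathcal M,\tau)$-gradient-Lipschitz and $(\rho,\mathcal M,\tau)$-Hessian-Lipschitz. Assume that $\mathcal M$ is closed under gradient descent updates, i.e. $x-\eta'\nabla f(x)\in\mathcal M$ for every $x\in\mathcal M$ and every $\eta'>0$. Let $x_t\in\mathbb{R}^d$ satisfy $\|x_t^\perp\|\le\tau$. Then, for any stepsize $0<\eta\le1/L$, the single update $x_{t+1}=x_t-\eta\nabla f(x_t)$ satisfies $$\|x_{t+1}^\perp\|\le\Big(1+\frac\eta2\,r(x_t)+\frac{\eta\rho}{2}\|x_t^\perp\|\Big)\|x_t^\perp\|.$$
   Context: $f:\mathbb{R}^d\to\mathbb{R}$ is twice differentiable; $\mathcal M\subseteq\mathbb{R}^d$ is a nonempty set (the implicit region) for which nearest points exist. $\|\cdot\|$ is the Euclidean/operator norm. $\mathcal N_{\mathcal M}(\tau)=\{x:\operatorname{dist}(x,\mathcal M)\le\tau\}$, $\tau>0$. For each $x$, $x^\sharp=\mathcal P_{\mathcal M}(x)\in\arg\min_{y\in\mathcal M}\|x-y\|$ (an arbitrary fixed choice of minimizer) and $x^\perp=x-x^\sharp$. $f$ is $(L,\mathcal M,\tau)$-gradient-Lipschitz if $\|\nabla f(x)-\nabla f(x')\|\le L\|x-x'\|$ for all $x,x'\in\mathcal N_{\mathcal M}(\tau)$, and $(\rho,\mathcal M,\tau)$-Hessian-Lipschitz if $\|\nabla^2 f(x)-\nabla^2 f(x')\|\le\rho\|x-x'\|$ for all $x,x'\in\mathcal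 N_{\mathcal M}(\tau)$. Deviation rate: write $\nabla^2f(x)=\nabla^2_+f(x)+\nabla^2_-f(x)$ for the decomposition of the Hessian into its positive and negative semidefinite parts (from the eigendecomposition, keeping respectively the nonnegative and nonpositive eigenvalues). If $x^\perp\ne0$, $r_-(x)=-\|x^\perp\|^{-2}\langle x^\perp,\nabla^2_+f(x^\sharp)x^\perp\rangle$ and $r_+(x)=-\|x^\perp\|^{-2}\langle x^\perp,\nabla^2_-f(x^\sharp)x^\perp\rangle$; both are $0$ if $x^\perp=0$. The deviation rate is $r(x)=r_-(x)+3r_+(x)$. *)

theory Defs
  imports "HOL-Analysis.Analysis"
begin

definition gradient :: "(real^'d \<Rightarrow> real) \<Rightarrow> real^'d \<Rightarrow> real^'d" where
  "gradient f x = (THE D. GDERIV f x :> D)"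

definition hessian :: "(real^'d \<Rightarrow> real) \<Rightarrow> real^'d \<Rightarrow> real^'d^'d" where
  "hessian f x = jacobian (gradient f) (at x)"

definition twice_differentiable :: "(real^'d \<Rightarrow> real) \<Rightarrow> bool" where
  "twice_differentiable f \<longleftrightarrow>
     (\<forall>x. f differentiable (at x)) \<and> (\<forall>x. gradient f differentiable (at x))"

lemma gradient_eqI:
  assumes "GDERIV f x :> D"
  shows "gradient f x = D"
proof -
  have "D' = D" if "GDERIV f x :> D'" for D'
  proof -
    have "(\<lambda>h. inner h D') = (\<lambda>h. inner h D)"
      using that assms unfolding gderiv_def by (rule has_derivative_unique)
    then have "inner (D' - D) D' = inner (D' - D) D"
      by (rule fun_cong)
    then have "inner (D' - D) (D' - D) = 0"
      by (simp add: inner_diff_right)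
    then show ?thesis
      by simp
  qed
  with assms show ?thesis
    unfolding gradient_def by (rule the_equality)
qed

text \<open>The library norm on matrices is the Frobenius norm, so the operator norm is
  taken of the induced linear map.\<close>

definition op_norm :: "real^'d^'d \<Rightarrow> real" where
  "op_norm A = onorm ((*v) A)"

definition diag_matrix :: "('d \<Rightarrow> real) \<Rightarrow> real^'d^'d" where
  "diag_matrix l = (\<chi> i j. if i = j then l i else 0)"

definition eigendecomposition :: "real^'d^'d \<Rightarrow> real^'d^'d \<Rightarrow> ('d \<Rightarrow> real) \<Rightarrow> bool" where
  "eigendecomposition A Q l \<longleftrightarrow>
     orthogonal_matrix Q \<and> A = Q ** diag_matrix l ** transpose Q"

text \<open>The matrix obtained from a symmetric matrix by applying \<open>g\<close> to its eigenvalues.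
  It does not depend on the eigendecomposition chosen (\<open>spectral_map_eqI\<close> below);
  it is unspecified for a matrix without an orthogonal eigendecomposition, that is,
  a non-symmetric one.\<close>

definition spectral_map :: "(real \<Rightarrow> real) \<Rightarrow> real^'d^'d \<Rightarrow> real^'d^'d" where
  "spectral_map g A =
     (THE B. \<exists>Q l. eigendecomposition A Q l \<and> eigendecomposition B Q (\<lambda>i. g (l i)))"

definition psd_part :: "real^'d^'d \<Rightarrow> real^'d^'d" where
  "psd_part = spectral_map (\<lambda>c. max c 0)"

definition nsd_part :: "real^'d^'d \<Rightarrow> real^'d^'d" where
  "nsd_part = spectral_map (\<lambda>c. min c 0)"

lemma matrix_mult_diag_nth: "(W ** diag_matrix l) $ i $ j = W $ i $ j * l j"
  by (simp add: matrix_matrix_mult_def diag_matrix_def if_distrib cong: if_cong)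

lemma diag_mult_matrix_nth: "(diag_matrix l ** W) $ i $ j = l i * W $ i $ j"
proof -
  have "(\<Sum>k\<in>UNIV. (if i = k then l i else 0) * W $ k $ j) =
        (\<Sum>k\<in>UNIV. if i = k then l i * W $ k $ j else 0)"
    by (intro sum.cong) auto
  then show ?thesis
    by (simp add: matrix_matrix_mult_def diag_matrix_def)
qed

lemma eigendecomposition_map_unique:
  assumes Q: "eigendecomposition A Q l" "eigendecomposition B Q (\<lambda>i. g (l i))"
    and R: "eigendecomposition A R m" "eigendecomposition C R (\<lambda>i. g (m i))"
  shows "B = C"
proof -
  define W where "W = transpose R ** Q"
  have QQ: "transpose Q ** Q = mat 1" "Q ** transpose Q = mat 1"
    and RR: "transpose R ** R = mat 1" "R ** transpose R = mat 1"
    using Q R by (auto simp: eigendecomposition_def orthogonal_matrix_def)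
  have conj: "transpose R ** (Q ** D ** transpose Q) ** Q = W ** D" for D
    using QQ(1) by (simp add: W_def flip: matrix_mul_assoc)
  have conj': "transpose R ** (R ** D ** transpose R) ** Q = D ** W" for D
    using RR(1) by (simp add: W_def matrix_mul_assoc)
  have "W ** diag_matrix l = diag_matrix m ** W"
    using conj[of "diag_matrix l"] conj'[of "diag_matrix m"] Q(1) R(1)
    by (simp add: eigendecomposition_def)
  then have "W $ i $ j * l j = m i * W $ i $ j" for i j
    by (simp flip: matrix_mult_diag_nth diag_mult_matrix_nth)
  then have "W $ i $ j = 0 \<or> l j = m i" for i j
    by (simp add: mult.commute)
  then have "W $ i $ j * g (l j) = g (m i) * W $ i $ j" for i j
    using mult.commute by fastforce
  then have "W ** diag_matrix (\<lambda>i. g (l i)) = diag_matrix (\<lambda>i. g (m i)) ** W"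
    by (simp add: vec_eq_iff matrix_mult_diag_nth diag_mult_matrix_nth)
  then have "transpose R ** B ** Q = transpose R ** C ** Q"
    using conj[of "diag_matrix (\<lambda>i. g (l i))"] conj'[of "diag_matrix (\<lambda>i. g (m i))"] Q(2) R(2)
    by (simp add: eigendecomposition_def)
  then have "R ** (transpose R ** B ** Q) ** transpose Q =
             R ** (transpose R ** C ** Q) ** transpose Q"
    by simp
  moreover have "R ** (transpose R ** X ** Q) ** transpose Q = X" for X
  proof -
    have "R ** (transpose R ** X ** Q) ** transpose Q =
          (R ** transpose R) ** X ** (Q ** transpose Q)"
      by (simp add: matrix_mul_assoc)
    then show ?thesis
      using QQ(2) RR(2) by simp
  qed
  ultimately show ?thesis
    by simp
qed

lemma spectral_map_eqI:
  assumes "eigendecomposition A Q l"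
  shows "spectral_map g A = Q ** diag_matrix (\<lambda>i. g (l i)) ** transpose Q"
  unfolding spectral_map_def
proof (rule the_equality)
  show "\<exists>Q' l'. eigendecomposition A Q' l' \<and>
      eigendecomposition (Q ** diag_matrix (\<lambda>i. g (l i)) ** transpose Q) Q' (\<lambda>i. g (l' i))"
    using assms by (auto simp: eigendecomposition_def)
next
  fix B
  assume "\<exists>Q' l'. eigendecomposition A Q' l' \<and> eigendecomposition B Q' (\<lambda>i. g (l' i))"
  moreover have
    "eigendecomposition (Q ** diag_matrix (\<lambda>i. g (l i)) ** transpose Q) Q (\<lambda>i. g (l i))"
    using assms by (simp add: eigendecomposition_def)
  ultimately show "B = Q ** diag_matrix (\<lambda>i. g (l i)) ** transpose Q"
    using assms eigendecomposition_map_unique by blast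
qed

definition neighborhood :: "(real^'d) set \<Rightarrow> real \<Rightarrow> (real^'d) set" where
  "neighborhood M \<tau> = {x. infdist x M \<le> \<tau>}"

definition gradient_Lipschitz ::
  "real \<Rightarrow> (real^'d) set \<Rightarrow> real \<Rightarrow> (real^'d \<Rightarrow> real) \<Rightarrow> bool" where
  "gradient_Lipschitz L M \<tau> f \<longleftrightarrow>
     (\<forall>x\<in>neighborhood M \<tau>. \<forall>x'\<in>neighborhood M \<tau>.
        norm (gradient f x - gradient f x') \<le> L * norm (x - x'))"

definition hessian_Lipschitz ::
  "real \<Rightarrow> (real^'d) set \<Rightarrow> real \<Rightarrow> (real^'d \<Rightarrow> real) \<Rightarrow> bool" where
  "hessian_Lipschitz \<rho> M \<tau> f \<longleftrightarrow>
     (\<forall>x\<in>neighborhood M \<tau>. \<forall>x'\<in>neighborhood M \<tau>.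
        op_norm (hessian f x - hessian f x') \<le> \<rho> * norm (x - x'))"

text \<open>A fixed selection \<open>P\<close> of nearest points. Its existence includes the attainment of the
  distance to \<open>M\<close>; no uniqueness or regularity of \<open>P\<close> is required.\<close>

definition nearest_point_map :: "(real^'d) set \<Rightarrow> (real^'d \<Rightarrow> real^'d) \<Rightarrow> bool" where
  "nearest_point_map M P \<longleftrightarrow> (\<forall>x. is_arg_min (\<lambda>y. norm (x - y)) (\<lambda>y. y \<in> M) (P x))"

definition perp :: "(real^'d \<Rightarrow> real^'d) \<Rightarrow> real^'d \<Rightarrow> real^'d" where
  "perp P x = x - P x"

definition deviation_minus ::
  "(real^'d \<Rightarrow> real) \<Rightarrow> (real^'d \<Rightarrow> real^'d) \<Rightarrow> real^'d \<Rightarrow> real" where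
  "deviation_minus f P x =
     (if perp P x = 0 then 0
      else - (inner (perp P x) (psd_part (hessian f (P x)) *v perp P x) / (norm (perp P x))\<^sup>2))"

definition deviation_plus ::
  "(real^'d \<Rightarrow> real) \<Rightarrow> (real^'d \<Rightarrow> real^'d) \<Rightarrow> real^'d \<Rightarrow> real" where
  "deviation_plus f P x =
     (if perp P x = 0 then 0
      else - (inner (perp P x) (nsd_part (hessian f (P x)) *v perp P x) / (norm (perp P x))\<^sup>2))"

definition deviation_rate ::
  "(real^'d \<Rightarrow> real) \<Rightarrow> (real^'d \<Rightarrow> real^'d) \<Rightarrow> real^'d \<Rightarrow> real" where
  "deviation_rate f P x = deviation_minus f P x + 3 * deviation_plus f P x"

end

theory Submission
  imports Defs
begin

text \<open>Write \<open>s\<close> for the nearest point of \<open>x\<close>, \<open>v = x - s\<close> and \<open>H\<close> for the Hessian at \<open>s\<close>. The step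
  from \<open>s\<close> stays in \<open>M\<close>, so the new distance is at most
  \<open>\<parallel>v - \<eta> (\<nabla>f x - \<nabla>f s)\<parallel> \<le> \<parallel>v - \<eta> H v\<parallel> + \<eta> \<rho> \<parallel>v\<parallel>\<^sup>2 / 2\<close>. The eigenvalues of \<open>\<eta> H\<close> lie in
  \<open>[-1, 1]\<close>, so in an eigenbasis \<open>\<parallel>v - \<eta> H v\<parallel>\<^sup>2 \<le> (1 + \<eta> r) \<parallel>v\<parallel>\<^sup>2\<close> with \<open>r\<close> the deviation rate,
  and \<open>sqrt (1 + \<eta> r) \<le> 1 + \<eta> r / 2\<close>.\<close>

section \<open>Spectral theorem for self-adjoint maps and symmetric matrices\<close>

text \<open>A maximiser of the Rayleigh quotient on the compact unit sphere of \<open>S\<close> is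
  an eigenvector. Working in an invariant subspace lets eigenvectors be split off one at a
  time.\<close>

lemma self_adjoint_eigenvector:
  fixes T :: "'a::euclidean_space \<Rightarrow> 'a"
  assumes "linear T" and adj: "\<And>x y. inner (T x) y = inner x (T y)"
    and S: "subspace S" "T ` S \<subseteq> S" "S \<noteq> {0}"
  obtains u c where "u \<in> S" "norm u = 1" "T u = c *\<^sub>R u"
proof -
  interpret T: linear T by fact
  have "compact (sphere 0 1 \<inter> S)"
    using S(1) by (simp add: closed_subspace compact_Int_closed)
  moreover have "sphere 0 1 \<inter> S \<noteq> {}"
  proof -
    obtain x where x: "x \<in> S" "x \<noteq> 0"
      using S subspace_0 by blast
    then have "(1 / norm x) *\<^sub>R x \<in> sphere 0 1 \<inter> S"
      using S(1) by (simp add: subspace_scale)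
    then show ?thesis by blast
  qed
  moreover have "continuous_on (sphere 0 1 \<inter> S) (\<lambda>x. inner x (T x))"
    using \<open>linear T\<close>
    by (intro continuous_on_inner continuous_on_id linear_continuous_on)
      (simp add: linear_conv_bounded_linear)
  ultimately obtain u where "u \<in> sphere 0 1 \<inter> S"
    and "\<forall>y\<in>sphere 0 1 \<inter> S. inner y (T y) \<le> inner u (T u)"
    using continuous_attains_sup[of "sphere 0 1 \<inter> S" "\<lambda>x. inner x (T x)"] by blast
  then have u: "u \<in> S" "norm u = 1"
    and max: "\<And>y. y \<in> S \<Longrightarrow> norm y = 1 \<Longrightarrow> inner y (T y) \<le> inner u (T u)"
    by auto
  define c where "c = inner u (T u)"
  have uu: "inner u u = 1"
    using u(2) by (simp add: norm_eq_1)
  \<comment> \<open>Homogeneity carries the maximality from unit vectors to all of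
    \<open>S\<close>.\<close>
  have le: "inner y (T y) \<le> c * inner y y" if "y \<in> S" for y
  proof (cases "y = 0")
    case False
    have "inner ((1 / norm y) *\<^sub>R y) (T ((1 / norm y) *\<^sub>R y)) \<le> c"
      unfolding c_def using False that S(1) by (intro max) (auto simp: subspace_scale)
    then have "inner y (T y) / (norm y)\<^sup>2 \<le> c"
      by (simp add: T.scale power2_eq_square field_simps)
    then show ?thesis
      using False by (simp add: divide_le_eq power2_norm_eq_inner)
  qed (simp add: T.zero)
  \<comment> \<open>\<open>w\<close> is the part of \<open>T u\<close> orthogonal to
    \<open>u\<close>; it has to vanish.\<close>
  define w where "w = T u - c *\<^sub>R u"
  have "inner u w = 0"
    by (simp add: w_def c_def inner_diff_right uu)
  then have w: "w \<in> S" "inner w u = 0" "inner u w = 0"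
    using u(1) S(1,2) by (auto simp: w_def inner_commute intro!: subspace_diff subspace_scale)
  have wT: "inner w (T u) = inner w w"
  proof -
    have "T u = w + c *\<^sub>R u"
      by (simp add: w_def)
    then show ?thesis
      using w(2) by (simp add: inner_add_right)
  qed
  text \<open>Perturbing the maximiser \<open>u\<close> of the Rayleigh quotient in the direction \<open>w\<close>
    gives a first-order gain of \<open>2 t \<parallel>w\<parallel>\<^sup>2\<close>, so \<open>w = 0\<close>.\<close>
  have *: "2 * t * inner w w \<le> t\<^sup>2 * (c * inner w w - inner w (T w))" for t
  proof -
    have "inner (u + t *\<^sub>R w) (T (u + t *\<^sub>R w)) \<le> c * inner (u + t *\<^sub>R w) (u + t *\<^sub>R w)"
      using u w S(1) by (intro le) (auto simp: subspace_add subspace_scale)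
    moreover have "inner u (T w) = inner w w"
      using adj[of u w] wT by (simp add: inner_commute)
    then have "inner (u + t *\<^sub>R w) (T (u + t *\<^sub>R w)) =
        c + 2 * t * inner w w + t\<^sup>2 * inner w (T w)"
      using wT by (simp add: T.add T.scale inner_add_left inner_add_right c_def power2_eq_square
          distrib_left)
    moreover have "inner (u + t *\<^sub>R w) (u + t *\<^sub>R w) = 1 + t\<^sup>2 * inner w w"
      using w uu by (simp add: inner_add_left inner_add_right power2_eq_square)
    ultimately have "c + 2 * t * inner w w + t\<^sup>2 * inner w (T w) \<le> c * (1 + t\<^sup>2 * inner w w)"
      by simp
    then show ?thesis
      by (simp add: algebra_simps)
  qed
  have "inner w w = 0"
  proof (rule ccontr)
    assume "inner w w \<noteq> 0"
    then have pos: "inner w w > 0" by simp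
    \<comment> \<open>The summand 1 keeps \<open>K\<close> positive. With this \<open>t\<close> the
      quadratic term is at most \<open>t * inner w w\<close>, half of the first-order gain.\<close>
    define K where "K = \<bar>c * inner w w - inner w (T w)\<bar> + 1"
    define t where "t = inner w w / K"
    have "K > 0" unfolding K_def by linarith
    then have t: "t > 0" using pos by (simp add: t_def)
    have "2 * t * inner w w \<le> t\<^sup>2 * K"
      using *[of t] by (rule order_trans) (auto simp: K_def intro!: mult_left_mono)
    also have "\<dots> = t * inner w w"
      using \<open>K > 0\<close> by (simp add: t_def power2_eq_square)
    finally show False
      using mult_pos_pos[OF t pos] by linarith
  qed
  then have "T u = c *\<^sub>R u" by (simp add: w_def)
  with u that show ?thesis by blast
qed

text \<open>Induction on the dimension: since \<open>T\<close> is self-adjoint, the orthogonal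
  complement in \<open>S\<close> of an eigenvector is again invariant, and its eigenbasis is
  extended by that eigenvector.\<close>

lemma self_adjoint_orthonormal_eigenbasis:
  fixes T :: "'a::euclidean_space \<Rightarrow> 'a"
  assumes T: "linear T" "\<And>x y. inner (T x) y = inner x (T y)"
    and S: "subspace S" "T ` S \<subseteq> S"
  shows "\<exists>B. pairwise orthogonal B \<and> (\<forall>b\<in>B. norm b = 1) \<and> span B = S \<and>
    (\<forall>b\<in>B. \<exists>c. T b = c *\<^sub>R b)"
  using S
proof (induction "dim S" arbitrary: S rule: less_induct)
  case less
  show ?case
  proof (cases "S = {0}")
    case True
    then show ?thesis by (intro exI[of _ "{}"]) (auto simp: pairwise_def)
  next
    case False
    obtain u c where u: "u \<in> S" "norm u = 1" "T u = c *\<^sub>R u"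
      using self_adjoint_eigenvector[OF T less.prems False] by blast
    have uu: "inner u u = 1"
      using u(2) by (simp add: norm_eq_1)
    define S' where "S' = S \<inter> {w. inner u w = 0}"
    have sub: "subspace S'"
      unfolding S'_def using less.prems by (intro subspace_inter subspace_hyperplane)
    have "T ` S' \<subseteq> S'"
    proof
      fix y assume "y \<in> T ` S'"
      then obtain w where w: "w \<in> S" "inner u w = 0" "y = T w" by (auto simp: S'_def)
      then have "inner u (T w) = 0" using T(2)[of u w] u(3) by simp
      then show "y \<in> S'" using w less.prems by (auto simp: S'_def)
    qed
    moreover have "dim S' < dim S"
    proof -
      have "u \<notin> S'" by (simp add: S'_def uu)
      then have "S' \<noteq> S" using u(1) by blast
      then have "S' \<subset> S" by (auto simp: S'_def)
      then show ?thesis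
        using dim_psubset[of S' S] span_eq_iff sub less.prems(1) by metis
    qed
    ultimately obtain B where B: "pairwise orthogonal B" "\<And>b. b \<in> B \<Longrightarrow> norm b = 1"
      "span B = S'" "\<And>b. b \<in> B \<Longrightarrow> \<exists>c. T b = c *\<^sub>R b"
      using less.hyps[of S'] sub by blast
    have "B \<subseteq> S'" using B(3) span_superset by blast
    then have orth: "inner u b = 0" "b \<in> S" if "b \<in> B" for b
      using that by (auto simp: S'_def)
    have "S \<subseteq> span (insert u B)"
    proof
      fix x assume x: "x \<in> S"
      have "x - inner u x *\<^sub>R u \<in> S'"
        using x u less.prems(1)
        by (auto simp: S'_def inner_diff_right uu subspace_diff subspace_scale)
      then show "x \<in> span (insert u B)"
        using B(3) span_breakdown_eq by blast
    qed
    moreover have "span (insert u B) \<subseteq> S"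
      using u(1) orth less.prems(1) by (intro span_minimal) auto
    ultimately have "span (insert u B) = S" by blast
    moreover have "pairwise orthogonal (insert u B)"
      using B(1) orth by (auto simp: pairwise_insert orthogonal_def inner_commute)
    ultimately show ?thesis
      using B u by (intro exI[of _ "insert u B"]) auto
  qed
qed

lemma symmetric_matrix_inner:
  fixes A :: "real^'n^'n"
  assumes "transpose A = A"
  shows "inner (A *v x) y = inner x (A *v y)"
  by (metis assms dot_lmul_matrix vector_transpose_matrix)

text \<open>Orthonormal eigenvectors as the columns of \<open>Q\<close> diagonalise
  \<open>A\<close>. Hence \<open>spectral_map\<close> is specified at every symmetric
  matrix.\<close>

lemma eigendecomposition_symmetric:
  fixes A :: "real^'d^'d"
  assumes "transpose A = A"
  obtains Q l where "eigendecomposition A Q l"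
proof -
  obtain B where B: "pairwise orthogonal B" "\<And>b. b \<in> B \<Longrightarrow> norm b = 1"
      "span B = UNIV" "\<And>b. b \<in> B \<Longrightarrow> \<exists>c. A *v b = c *\<^sub>R b"
    using self_adjoint_orthonormal_eigenbasis[of "(*v) A" UNIV]
      symmetric_matrix_inner[OF assms] by auto
  have "independent B"
    using B by (intro pairwise_orthogonal_independent) force+
  then have "finite B" "card B = CARD('d)"
    using B(3) by (auto simp: finiteI_independent dim_eq_card_independent
        simp flip: dim_span_eq_card_independent)
  \<comment> \<open>The basis has as many vectors as \<open>'d\<close> has elements, so it can be
    indexed by \<open>'d\<close> to form columns.\<close>
  then obtain b where b: "bij_betw b (UNIV :: 'd set) B"
    by (metis finite_class.finite_UNIV finite_same_card_bij)
  then have bB: "b i \<in> B" for i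
    by (auto simp: bij_betw_def)
  then have "\<forall>i. \<exists>c. A *v b i = c *\<^sub>R b i"
    using B(4) by blast
  from choice[OF this] obtain l where l: "\<And>i. A *v b i = l i *\<^sub>R b i"
    by blast
  define Q :: "real^'d^'d" where "Q = (\<chi> i j. b j $ i)"
  have col: "column j Q = b j" for j
    by (simp add: Q_def column_def)
  have Q: "orthogonal_matrix Q"
    using B(1,2) bB b
    by (auto simp: orthogonal_matrix_orthonormal_columns col pairwise_def bij_betw_def inj_eq)
  have "A ** Q = Q ** diag_matrix l"
  proof -
    have "(A ** Q) $ i $ j = (A *v b j) $ i" for i j
      by (simp add: matrix_matrix_mult_def matrix_vector_mult_def Q_def)
    then show ?thesis
      by (simp add: vec_eq_iff matrix_mult_diag_nth l Q_def mult.commute)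
  qed
  then have "A ** (Q ** transpose Q) = Q ** diag_matrix l ** transpose Q"
    by (simp add: matrix_mul_assoc)
  then have "A = Q ** diag_matrix l ** transpose Q"
    using Q by (simp add: orthogonal_matrix_def)
  then show ?thesis
    using Q that by (auto simp: eigendecomposition_def)
qed

section \<open>Quadratic forms and one gradient step in eigenbasis coordinates\<close>

lemma diag_matrix_vector_nth: "(diag_matrix l *v w) $ i = l i * w $ i"
proof -
  have "(\<Sum>k\<in>UNIV. (if i = k then l i else 0) * w $ k) =
      (\<Sum>k\<in>UNIV. if i = k then l i * w $ k else 0)"
    by (intro sum.cong) auto
  then show ?thesis
    by (simp add: matrix_vector_mult_def diag_matrix_def)
qed

lemma orthogonal_matrix_norm:
  fixes Q :: "real^'d^'d"
  assumes "orthogonal_matrix Q"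
  shows "norm (Q *v w) = norm w"
  using assms orthogonal_transformation_matrix[of "(*v) Q"] orthogonal_transformation_norm
  by fastforce

lemma norm_power2_eq_sum:
  fixes w :: "real^'d"
  shows "(norm w)\<^sup>2 = (\<Sum>i\<in>UNIV. (w $ i)\<^sup>2)"
  unfolding power2_norm_eq_inner inner_vec_def by (simp add: power2_eq_square)

text \<open>Moving \<open>Q\<close> to the other side of the inner product leaves a diagonal form.
  Taking for \<open>m\<close> the positive or negative parts of the eigenvalues evaluates the two
  terms of the deviation rate.\<close>

lemma inner_conjugate_diag:
  fixes Q :: "real^'d^'d"
  shows "inner v ((Q ** diag_matrix m ** transpose Q) *v v) =
    (\<Sum>i\<in>UNIV. m i * ((transpose Q *v v) $ i)\<^sup>2)"
proof -
  have "inner v ((Q ** diag_matrix m ** transpose Q) *v v) =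
      inner v (Q *v (diag_matrix m *v (transpose Q *v v)))"
    by (simp add: matrix_vector_mul_assoc matrix_mul_assoc del: transpose_matrix_vector)
  also have "\<dots> = inner (transpose Q *v v) (diag_matrix m *v (transpose Q *v v))"
    by (simp flip: dot_lmul_matrix)
  also have "\<dots> = (\<Sum>i\<in>UNIV. m i * ((transpose Q *v v) $ i)\<^sup>2)"
    by (simp add: inner_vec_def diag_matrix_vector_nth power2_eq_square mult_ac)
  finally show ?thesis .
qed

text \<open>Column \<open>i\<close> of \<open>Q\<close> is a unit eigenvector for
  \<open>l i\<close>; the norm bound is tested on it.\<close>

lemma eigenvalue_bound:
  fixes A :: "real^'d^'d"
  assumes "eigendecomposition A Q l" and "\<And>v. norm (A *v v) \<le> L * norm v"
  shows "\<bar>l i\<bar> \<le> L"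
proof -
  have Q: "orthogonal_matrix Q" "A = Q ** diag_matrix l ** transpose Q"
    using assms by (auto simp: eigendecomposition_def)
  define v where "v = Q *v axis i 1"
  have "transpose Q *v v = axis i 1"
    using Q(1) by (simp add: v_def matrix_vector_mul_assoc orthogonal_matrix_def
        del: transpose_matrix_vector)
  then have "A *v v = Q *v (diag_matrix l *v axis i 1)"
    using Q(2) by (simp flip: matrix_vector_mul_assoc)
  moreover have "diag_matrix l *v axis i 1 = l i *\<^sub>R axis i 1"
    by (simp add: vec_eq_iff diag_matrix_vector_nth axis_def)
  ultimately have "norm (A *v v) = \<bar>l i\<bar>" "norm v = 1"
    using Q(1) by (simp_all add: orthogonal_matrix_norm v_def)
  then show ?thesis
    using assms(2)[of v] by simp
qed

text \<open>The weights 1 and 3 of the deviation rate come from the eigenvalue bounds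
  \<open>(1 - c)\<^sup>2 \<le> 1 - c\<close> for \<open>0 \<le> c \<le> 1\<close> and \<open>(1 - c)\<^sup>2 \<le> 1 - 3 * c\<close> for \<open>-1 \<le> c \<le> 0\<close>.\<close>

lemma norm_gradient_step_le:
  fixes A :: "real^'d^'d"
  assumes sym: "transpose A = A" and bound: "\<And>v. norm (A *v v) \<le> L * norm v"
    and "0 \<le> \<eta>" "\<eta> * L \<le> 1"
  shows "(norm (v - \<eta> *\<^sub>R (A *v v)))\<^sup>2 \<le>
    (norm v)\<^sup>2 - \<eta> * (inner v (psd_part A *v v) + 3 * inner v (nsd_part A *v v))"
proof -
  obtain Q l where E: "eigendecomposition A Q l"
    using eigendecomposition_symmetric[OF sym] .
  then have Q: "orthogonal_matrix Q" and A: "A = Q ** diag_matrix l ** transpose Q"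
    by (auto simp: eigendecomposition_def)
  define w where "w = transpose Q *v v"
  have v: "v = Q *v w"
    using Q by (simp add: w_def matrix_vector_mul_assoc orthogonal_matrix_def
        del: transpose_matrix_vector)
  have "A *v v = Q *v (diag_matrix l *v w)"
    by (simp add: A w_def matrix_vector_mul_assoc matrix_mul_assoc del: transpose_matrix_vector)
  then have "v - \<eta> *\<^sub>R (A *v v) = Q *v (w - \<eta> *\<^sub>R (diag_matrix l *v w))"
    by (simp add: v matrix_vector_mult_diff_distrib matrix_vector_mult_scaleR)
  then have "(norm (v - \<eta> *\<^sub>R (A *v v)))\<^sup>2 = (\<Sum>i\<in>UNIV. (1 - \<eta> * l i)\<^sup>2 * (w $ i)\<^sup>2)"
    using Q by (simp add: orthogonal_matrix_norm norm_power2_eq_sum diag_matrix_vector_nth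
        flip: power_mult_distrib) (simp add: algebra_simps)
  also have "\<dots> \<le> (\<Sum>i\<in>UNIV. (w $ i)\<^sup>2 -
      \<eta> * (max (l i) 0 * (w $ i)\<^sup>2 + 3 * (min (l i) 0 * (w $ i)\<^sup>2)))"
  proof (rule sum_mono)
    fix i
    define c where "c = \<eta> * l i"
    have "\<eta> * \<bar>l i\<bar> \<le> 1"
      using mult_left_mono[OF eigenvalue_bound[OF E bound, where i = i] assms(3)] assms(4)
      by (rule order_trans)
    then have c: "\<bar>c\<bar> \<le> 1"
      using assms(3) by (simp add: c_def abs_mult)
    have c_max: "\<eta> * max (l i) 0 = max c 0" and c_min: "\<eta> * min (l i) 0 = min c 0"
      using assms(3) by (auto simp: c_def max_mult_distrib_left min_mult_distrib_left)
    have "(1 - c)\<^sup>2 \<le> 1 - max c 0 - 3 * min c 0"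
    proof (cases "c \<ge> 0")
      case True
      then have "c * c \<le> c * 1" using c by (intro mult_left_mono) auto
      then show ?thesis using True by (simp add: power2_eq_square algebra_simps)
    next
      case False
      then have "c * (1 + c) \<le> 0" using c by (intro mult_nonpos_nonneg) auto
      then show ?thesis using False by (simp add: power2_eq_square algebra_simps)
    qed
    then have "(1 - c)\<^sup>2 * (w $ i)\<^sup>2 \<le> (1 - max c 0 - 3 * min c 0) * (w $ i)\<^sup>2"
      by (intro mult_right_mono) auto
    also have "\<dots> = (w $ i)\<^sup>2 - \<eta> * (max (l i) 0 * (w $ i)\<^sup>2 + 3 * (min (l i) 0 * (w $ i)\<^sup>2))"
      by (simp add: algebra_simps flip: c_max c_min)
    finally show "(1 - \<eta> * l i)\<^sup>2 * (w $ i)\<^sup>2 \<le>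
        (w $ i)\<^sup>2 - \<eta> * (max (l i) 0 * (w $ i)\<^sup>2 + 3 * (min (l i) 0 * (w $ i)\<^sup>2))"
      by (simp add: c_def)
  qed
  also have "\<dots> = (norm v)\<^sup>2 - \<eta> * (inner v (psd_part A *v v) + 3 * inner v (nsd_part A *v v))"
  proof -
    have "(norm v)\<^sup>2 = (\<Sum>i\<in>UNIV. (w $ i)\<^sup>2)"
      using Q by (simp add: v orthogonal_matrix_norm norm_power2_eq_sum)
    \<comment> \<open>Both parts are diagonalised by the same \<open>Q\<close> as \<open>A\<close>,
      so one coordinate vector \<open>w\<close> serves all three sums.\<close>
    moreover have "inner v (psd_part A *v v) = (\<Sum>i\<in>UNIV. max (l i) 0 * (w $ i)\<^sup>2)"
      and "inner v (nsd_part A *v v) = (\<Sum>i\<in>UNIV. min (l i) 0 * (w $ i)\<^sup>2)"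
      unfolding psd_part_def nsd_part_def spectral_map_eqI[OF E] inner_conjugate_diag w_def
      by (rule refl)+
    ultimately show ?thesis
      by (simp add: sum_subtractf sum.distrib flip: sum_distrib_left)
  qed
  finally show ?thesis .
qed

section \<open>Symmetry of the second derivative\<close>

text \<open>Both orders of differentiation are compared with the second difference
  \<open>f (s + t u + t v) - f (s + t u) - f (s + t v) + f s\<close>, which is symmetric in \<open>u\<close> and \<open>v\<close>.\<close>

lemma second_difference_bound:
  fixes f :: "'a::real_inner \<Rightarrow> real"
  assumes f: "\<And>x. (f has_derivative (\<lambda>h. inner h (F x))) (at x)"
    and "linear H" and "t > 0" and "t * (norm u + norm v) \<le> \<delta>"
    and H: "\<And>h. norm h \<le> \<delta> \<Longrightarrow> norm (F (s + h) - F s - H h) \<le> e * norm h" and "e \<ge> 0"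
  shows "\<bar>f (s + t *\<^sub>R u + t *\<^sub>R v) - f (s + t *\<^sub>R u) - f (s + t *\<^sub>R v) + f s - t\<^sup>2 * inner u (H v)\<bar>
    \<le> t\<^sup>2 * (2 * e * norm u * (norm u + norm v))"
proof -
  interpret H: linear H by fact
  \<comment> \<open>The increment of \<open>f\<close> along \<open>t v\<close>, based at a point
    moving along \<open>u\<close>. The second difference is \<open>g t - g 0\<close>, and the mean
    value theorem turns it into a difference of gradients.\<close>
  define g where "g \<theta> = f (s + t *\<^sub>R v + \<theta> *\<^sub>R u) - f (s + \<theta> *\<^sub>R u)" for \<theta>
  have g: "(g has_real_derivative inner u (F (s + t *\<^sub>R v + \<theta> *\<^sub>R u) - F (s + \<theta> *\<^sub>R u))) (at \<theta>)" for \<theta>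
  proof -
    have line: "((\<lambda>\<theta>. a + \<theta> *\<^sub>R u) has_derivative (\<lambda>k. k *\<^sub>R u)) (at \<theta>)" for a
      by (auto intro!: derivative_eq_intros)
    show ?thesis
      unfolding g_def has_field_derivative_def
      by (rule has_derivative_eq_rhs, rule has_derivative_diff;
          (rule has_derivative_compose[OF line f])?)
        (auto simp: inner_diff_right algebra_simps)
  qed
  obtain \<theta> where \<theta>: "0 < \<theta>" "\<theta> < t"
    and mvt: "g t - g 0 = (t - 0) * inner u (F (s + t *\<^sub>R v + \<theta> *\<^sub>R u) - F (s + \<theta> *\<^sub>R u))"
    using MVT2[OF \<open>t > 0\<close> g] by blast
  define h1 h2 where "h1 = t *\<^sub>R v + \<theta> *\<^sub>R u" and "h2 = \<theta> *\<^sub>R u"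
  have \<theta>u: "\<theta> * norm u \<le> t * norm u"
    using \<theta> by (simp add: mult_right_mono)
  have n1: "norm h1 \<le> t * (norm u + norm v)"
    unfolding h1_def using \<theta> \<open>t > 0\<close> \<theta>u
    by (intro order_trans[OF norm_triangle_ineq]) (simp add: algebra_simps)
  have n2: "norm h2 \<le> t * (norm u + norm v)"
    using \<theta> \<open>t > 0\<close> \<theta>u by (simp add: h2_def distrib_left add_increasing2)
  define r where "r h = F (s + h) - F s - H h" for h
  have r: "norm (r h) \<le> e * (t * (norm u + norm v))" if "norm h \<le> t * (norm u + norm v)" for h
    using H[of h] that assms(4) \<open>e \<ge> 0\<close> unfolding r_def
    by (meson mult_left_mono order_trans)
  \<comment> \<open>The contributions of \<open>\<theta> u\<close> cancel in
    \<open>H h1 - H h2\<close>.\<close>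
  have eq: "F (s + h1) - F (s + h2) = t *\<^sub>R H v + (r h1 - r h2)"
    by (simp add: r_def h1_def h2_def H.add H.scale)
  have "f (s + t *\<^sub>R u + t *\<^sub>R v) - f (s + t *\<^sub>R u) - f (s + t *\<^sub>R v) + f s = g t - g 0"
    by (simp add: g_def add_ac)
  also have "\<dots> = t * inner u (F (s + h1) - F (s + h2))"
    using mvt by (simp add: h1_def h2_def add_ac)
  also have "\<dots> = t\<^sup>2 * inner u (H v) + t * inner u (r h1 - r h2)"
    unfolding eq by (simp add: inner_add_right power2_eq_square distrib_left)
  finally have "\<bar>f (s + t *\<^sub>R u + t *\<^sub>R v) - f (s + t *\<^sub>R u) - f (s + t *\<^sub>R v) + f s - t\<^sup>2 * inner u (H v)\<bar>
      = t * \<bar>inner u (r h1 - r h2)\<bar>"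
    using \<open>t > 0\<close> by (simp add: abs_mult)
  also have "\<dots> \<le> t * (norm u * norm (r h1 - r h2))"
    using \<open>t > 0\<close> by (intro mult_left_mono Cauchy_Schwarz_ineq2) auto
  also have "\<dots> \<le> t * (norm u * (2 * (e * (t * (norm u + norm v)))))"
    using \<open>t > 0\<close> r[OF n1] r[OF n2] norm_triangle_ineq4[of "r h1" "r h2"]
    by (intro mult_left_mono) auto
  finally show ?thesis
    by (simp add: power2_eq_square mult_ac)
qed

text \<open>One and the same second difference is approximated to order \<open>t\<^sup>2\<close> by
  both sides; dividing by \<open>t\<^sup>2\<close> leaves an arbitrarily small error.\<close>

lemma gradient_derivative_symmetric:
  fixes f :: "'a::real_inner \<Rightarrow> real"
  assumes f: "\<And>x. (f has_derivative (\<lambda>h. inner h (F x))) (at x)"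
    and H: "(F has_derivative H) (at s)"
  shows "inner u (H v) = inner v (H u)"
proof -
  \<comment> \<open>The added 1 keeps \<open>N\<close> positive when \<open>u\<close> and
    \<open>v\<close> both vanish.\<close>
  define N where "N = norm u + norm v + 1"
  have "N > 0" by (simp add: N_def add_nonneg_pos)
  have lin: "linear H"
    using H by (rule has_derivative_linear)
  have "\<bar>inner u (H v) - inner v (H u)\<bar> \<le> e" if "e > 0" for e
  proof -
    \<comment> \<open>Chosen so that each of the two estimates costs at most \<open>e / 2\<close>
      after division by \<open>t\<^sup>2\<close>.\<close>
    define e' where "e' = e / (4 * N\<^sup>2)"
    have "e' > 0" using \<open>e > 0\<close> \<open>N > 0\<close> by (simp add: e'_def)
    then obtain d where "d > 0" and d: "\<And>y. norm (y - s) < d \<Longrightarrow>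
        norm (F y - F s - H (y - s)) \<le> e' * norm (y - s)"
      using H unfolding has_derivative_at_alt by blast
    \<comment> \<open>All increments then have length at most \<open>d / 2\<close>, inside the open
      ball of radius \<open>d\<close> where the derivative estimate holds.\<close>
    define t where "t = d / 2 / N"
    have "t > 0" using \<open>d > 0\<close> \<open>N > 0\<close> by (simp add: t_def)
    have "t * (norm u + norm v) \<le> t * N"
      using \<open>t > 0\<close> by (intro mult_left_mono) (auto simp: N_def)
    then have small: "t * (norm u + norm v) \<le> d / 2" "t * (norm v + norm u) \<le> d / 2"
      using \<open>N > 0\<close> by (simp_all add: t_def add.commute)
    have bnd: "norm (F (s + h) - F s - H h) \<le> e' * norm h" if "norm h \<le> d / 2" for h
      using d[of "s + h"] that \<open>d > 0\<close> by simp
    have est: "t\<^sup>2 * (2 * e' * norm a * (norm a + norm b)) \<le> t\<^sup>2 * (e / 2)"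
      if "norm a \<le> N" "norm a + norm b \<le> N" for a b :: 'a
    proof -
      have "norm a * (norm a + norm b) \<le> N * N"
        using that \<open>N > 0\<close> by (intro mult_mono) auto
      then have "2 * e' * (norm a * (norm a + norm b)) \<le> 2 * e' * (N * N)"
        using \<open>e' > 0\<close> by (intro mult_left_mono) auto
      also have "\<dots> = e / 2"
        using \<open>N > 0\<close> by (simp add: e'_def power2_eq_square)
      finally show ?thesis
        by (intro mult_left_mono) (auto simp: mult.assoc)
    qed
    let ?W = "f (s + t *\<^sub>R u + t *\<^sub>R v) - f (s + t *\<^sub>R u) - f (s + t *\<^sub>R v) + f s"
    have "\<bar>?W - t\<^sup>2 * inner u (H v)\<bar> \<le> t\<^sup>2 * (e / 2)"
      by (rule order_trans[OF second_difference_bound[OF f lin \<open>t > 0\<close> small(1) bnd] est])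
        (use \<open>e' > 0\<close> in \<open>auto simp: N_def\<close>)
    moreover have "\<bar>?W - t\<^sup>2 * inner v (H u)\<bar> \<le> t\<^sup>2 * (e / 2)"
    proof -
      have W: "?W = f (s + t *\<^sub>R v + t *\<^sub>R u) - f (s + t *\<^sub>R v) - f (s + t *\<^sub>R u) + f s"
        by (simp add: add_ac)
      show ?thesis
        unfolding W
        by (rule order_trans[OF second_difference_bound[OF f lin \<open>t > 0\<close> small(2) bnd] est])
          (use \<open>e' > 0\<close> in \<open>auto simp: N_def\<close>)
    qed
    ultimately have "\<bar>t\<^sup>2 * inner u (H v) - t\<^sup>2 * inner v (H u)\<bar> \<le> t\<^sup>2 * e"
      by argo
    then have "t\<^sup>2 * \<bar>inner u (H v) - inner v (H u)\<bar> \<le> t\<^sup>2 * e"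
      by (simp add: abs_mult flip: right_diff_distrib)
    then show ?thesis
      using \<open>t > 0\<close> by simp
  qed
  then have "\<bar>inner u (H v) - inner v (H u)\<bar> \<le> 0"
    by (rule field_le_epsilon) simp
  then show ?thesis by simp
qed

section \<open>Gradient and Hessian: symmetry, Lipschitz and Taylor bounds\<close>

text \<open>Since \<open>gradient\<close> is a definite description, a gradient vector must be
  exhibited: \<open>adjoint f' 1\<close> represents the functional \<open>f'\<close>.\<close>

lemma twice_differentiableD:
  fixes f :: "real^'d \<Rightarrow> real"
  assumes "twice_differentiable f"
  shows "(f has_derivative (\<lambda>h. inner h (gradient f x))) (at x)"
    and "(gradient f has_derivative (*v) (hessian f x)) (at x)"
proof -
  obtain f' where f': "(f has_derivative f') (at x)"
    using assms by (auto simp: twice_differentiable_def differentiable_def)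
  then have "linear f'" by (rule has_derivative_linear)
  then have "f' = (\<lambda>h. inner h (adjoint f' 1))"
    using adjoint_works[of f' _ 1] by (auto simp: fun_eq_iff)
  then have "GDERIV f x :> adjoint f' 1"
    using f' unfolding gderiv_def by metis
  then show "(f has_derivative (\<lambda>h. inner h (gradient f x))) (at x)"
    using gradient_eqI gderiv_def by metis
  show "(gradient f has_derivative (*v) (hessian f x)) (at x)"
    using assms by (auto simp: twice_differentiable_def hessian_def simp flip: jacobian_works)
qed

lemma transpose_hessian:
  fixes f :: "real^'d \<Rightarrow> real"
  assumes "twice_differentiable f"
  shows "transpose (hessian f x) = hessian f x"
proof -
  have "inner u (hessian f x *v v) = inner u (transpose (hessian f x) *v v)" for u v
    using gradient_derivative_symmetric[OF twice_differentiableD[OF assms], of u x v]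
    by (metis dot_lmul_matrix inner_commute vector_transpose_matrix)
  then have "hessian f x *v v = transpose (hessian f x) *v v" for v
    by (metis vector_eq_ldot)
  then show ?thesis
    by (metis matrix_eq)
qed

lemma norm_matrix_le_op_norm:
  fixes A :: "real^'d^'d"
  shows "norm (A *v v) \<le> op_norm A * norm v"
  unfolding op_norm_def by (intro onorm matrix_vector_mul_bounded_linear)

text \<open>On short multiples of \<open>v\<close>, \<open>H\<close> differs from an increment of
  \<open>F\<close> by at most \<open>e\<close> times the length, with \<open>e\<close> arbitrary.
  Applied to the gradient, this bounds the Hessian by \<open>L\<close>.\<close>

lemma has_derivative_norm_le_of_local_Lipschitz:
  fixes F :: "'a::real_normed_vector \<Rightarrow> 'b::real_normed_vector"
  assumes F: "(F has_derivative H) (at s)" and "\<tau> > 0"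
    and lip: "\<And>y. norm (y - s) \<le> \<tau> \<Longrightarrow> norm (F y - F s) \<le> L * norm (y - s)"
  shows "norm (H v) \<le> L * norm v"
proof (cases "v = 0")
  case True
  then show ?thesis
    using has_derivative_linear[OF F] by (simp add: linear_0)
next
  case False
  interpret H: linear H using F by (rule has_derivative_linear)
  have "norm (H v) / norm v \<le> L"
  proof (rule field_le_epsilon)
    fix e :: real assume "e > 0"
    then obtain d where "d > 0" and d: "\<And>y. norm (y - s) < d \<Longrightarrow>
        norm (F y - F s - H (y - s)) \<le> e * norm (y - s)"
      using F unfolding has_derivative_at_alt by blast
    \<comment> \<open>\<open>t v\<close> has length \<open>min (d / 2) \<tau>\<close>: strictly
      inside the derivative estimate and within the Lipschitz ball.\<close>
    define t where "t = min (d / 2) \<tau> / norm v"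
    have "t > 0" using \<open>d > 0\<close> \<open>\<tau> > 0\<close> False by (simp add: t_def)
    have tv: "norm (t *\<^sub>R v) < d" "norm (t *\<^sub>R v) \<le> \<tau>"
      using \<open>d > 0\<close> \<open>\<tau> > 0\<close> False by (auto simp: t_def)
    have "norm (H (t *\<^sub>R v)) \<le> norm (F (s + t *\<^sub>R v) - F s) + norm (F (s + t *\<^sub>R v) - F s - H (t *\<^sub>R v))"
      using norm_triangle_ineq4[of "F (s + t *\<^sub>R v) - F s" "F (s + t *\<^sub>R v) - F s - H (t *\<^sub>R v)"] by simp
    also have "\<dots> \<le> L * norm (t *\<^sub>R v) + e * norm (t *\<^sub>R v)"
      using lip[of "s + t *\<^sub>R v"] d[of "s + t *\<^sub>R v"] tv by (intro add_mono) auto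
    finally have "t * norm (H v) \<le> t * ((L + e) * norm v)"
      using \<open>t > 0\<close> by (simp add: H.scale algebra_simps)
    then show "norm (H v) / norm v \<le> L + e"
      using \<open>t > 0\<close> False by (simp add: divide_le_eq)
  qed
  then show ?thesis
    using False by (simp add: divide_le_eq)
qed

text \<open>A mean value inequality along the segment from \<open>s\<close> to \<open>s + v\<close>;
  the factor 1/2 comes from integrating a bound linear in \<open>t\<close>.\<close>

lemma gradient_taylor_bound:
  fixes f :: "real^'d \<Rightarrow> real"
  assumes f: "twice_differentiable f"
    and lip: "\<And>t. 0 < t \<Longrightarrow> t < 1 \<Longrightarrow>
      op_norm (hessian f (s + t *\<^sub>R v) - hessian f s) \<le> \<rho> * norm (t *\<^sub>R v)"
  shows "norm (gradient f (s + v) - gradient f s - hessian f s *v v) \<le> \<rho> / 2 * (norm v)\<^sup>2"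
proof -
  \<comment> \<open>Subtracting the linear part makes \<open>g'\<close> a difference of Hessians
    applied to \<open>v\<close>, and \<open>g 1 - g 0\<close> the Taylor remainder.\<close>
  define g where "g t = gradient f (s + t *\<^sub>R v) - t *\<^sub>R (hessian f s *v v)" for t :: real
  have g: "(g has_vector_derivative (hessian f (s + t *\<^sub>R v) - hessian f s) *v v) (at t)" for t
  proof -
    have line: "((\<lambda>t. s + t *\<^sub>R v) has_derivative (\<lambda>k. k *\<^sub>R v)) (at t)"
      by (auto intro!: derivative_eq_intros)
    have "((\<lambda>t. gradient f (s + t *\<^sub>R v)) has_derivative (\<lambda>k. hessian f (s + t *\<^sub>R v) *v (k *\<^sub>R v))) (at t)"
      by (rule has_derivative_compose[OF line twice_differentiableD(2)[OF f]])
    then have "((\<lambda>t. gradient f (s + t *\<^sub>R v)) has_vector_derivative hessian f (s + t *\<^sub>R v) *v v) (at t)"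
      by (simp add: has_vector_derivative_def matrix_vector_mult_scaleR)
    then show ?thesis
      unfolding g_def matrix_vector_mult_diff_rdistrib
      by (auto intro!: derivative_eq_intros)
  qed
  have "norm (g 1 - g 0) \<le> \<rho> / 2 * (norm v)\<^sup>2 * 1\<^sup>2 - \<rho> / 2 * (norm v)\<^sup>2 * 0\<^sup>2"
  proof (rule differentiable_bound_general[where \<phi>' = "\<lambda>t. \<rho> * t * (norm v)\<^sup>2", OF _ _ _ g])
    show "continuous_on {0..1} g"
      using g by (auto intro!: continuous_at_imp_continuous_on has_vector_derivative_continuous)
    show "((\<lambda>t. \<rho> / 2 * (norm v)\<^sup>2 * t\<^sup>2) has_vector_derivative \<rho> * t * (norm v)\<^sup>2) (at t)" for t
      unfolding has_real_derivative_iff_has_vector_derivative[symmetric]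
      by (auto intro!: derivative_eq_intros)
    fix t :: real assume t: "0 < t" "t < 1"
    have "norm ((hessian f (s + t *\<^sub>R v) - hessian f s) *v v) \<le>
        op_norm (hessian f (s + t *\<^sub>R v) - hessian f s) * norm v"
      by (rule norm_matrix_le_op_norm)
    also have "\<dots> \<le> \<rho> * norm (t *\<^sub>R v) * norm v"
      using lip[OF t] by (intro mult_right_mono) auto
    finally show "norm ((hessian f (s + t *\<^sub>R v) - hessian f s) *v v) \<le> \<rho> * t * (norm v)\<^sup>2"
      using t by (simp add: power2_eq_square mult_ac)
  qed (auto intro!: continuous_intros)
  then show ?thesis
    by (simp add: g_def algebra_simps)
qed

section \<open>Distance to \<open>M\<close> after one update\<close>

theorem proposition1:
  fixes f :: "real^'d \<Rightarrow> real"
    and M :: "(real^'d) set"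
    and P :: "real^'d \<Rightarrow> real^'d"
    and x :: "real^'d"
    and L \<rho> \<tau> \<eta> :: real
  assumes "twice_differentiable f"
    and "M \<noteq> {}"
    and "nearest_point_map M P"
    and "\<tau> > 0"
    and "gradient_Lipschitz L M \<tau> f"
    and "hessian_Lipschitz \<rho> M \<tau> f"
    and "\<forall>y\<in>M. \<forall>\<eta>'>0. y - \<eta>' *\<^sub>R gradient f y \<in> M"
    and "norm (perp P x) \<le> \<tau>"
    and "0 < \<eta>" and "\<eta> \<le> 1 / L"
  shows "norm (perp P (x - \<eta> *\<^sub>R gradient f x)) \<le>
    (1 + \<eta> / 2 * deviation_rate f P x + \<eta> * \<rho> / 2 * norm (perp P x)) * norm (perp P x)"
proof -
  define s v H where "s = P x" and "v = perp P x" and "H = hessian f s"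
  have x: "x = s + v"
    by (simp add: s_def v_def perp_def)
  have P: "P y \<in> M" "\<And>z. z \<in> M \<Longrightarrow> norm (perp P y) \<le> norm (y - z)" for y
    using assms(3) by (auto simp: nearest_point_map_def is_arg_min_linorder perp_def)
  have "s \<in> M" by (simp add: s_def P)
  have near: "y \<in> neighborhood M \<tau>" if "norm (y - s) \<le> \<tau>" for y
    using infdist_le[OF \<open>s \<in> M\<close>, of y] that by (simp add: neighborhood_def dist_norm)
  have near_s: "s \<in> neighborhood M \<tau>"
    using near[of s] \<open>\<tau> > 0\<close> by simp
  \<comment> \<open>Positivity of \<open>L\<close> is forced by the stepsize range:
    \<open>1 / L\<close> would be at most 0 otherwise, with \<open>1 / 0 = 0\<close> in HOL.\<close>
  have "L > 0"
    using assms(9,10) by (metis less_le_trans zero_less_divide_1_iff)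
  then have "\<eta> * L \<le> 1"
    using assms(10) by (simp add: field_simps)
  have bound: "norm (H *v u) \<le> L * norm u" for u
    unfolding H_def
    by (rule has_derivative_norm_le_of_local_Lipschitz[OF twice_differentiableD(2)[OF assms(1)] assms(4)])
      (use assms(5) near near_s in \<open>auto simp: gradient_Lipschitz_def\<close>)
  \<comment> \<open>The segment from \<open>s\<close> to \<open>x\<close> stays within
    \<open>\<tau>\<close> of \<open>s \<in> M\<close>, where the Hessian is Lipschitz.\<close>
  have taylor: "norm (gradient f x - gradient f s - H *v v) \<le> \<rho> / 2 * (norm v)\<^sup>2"
    unfolding x H_def
  proof (rule gradient_taylor_bound[OF assms(1)])
    fix t :: real assume t: "0 < t" "t < 1"
    then have "norm (t *\<^sub>R v) \<le> \<tau>"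
      using assms(8) mult_left_le_one_le[of "norm v" t] by (simp add: v_def)
    then show "op_norm (hessian f (s + t *\<^sub>R v) - hessian f s) \<le> \<rho> * norm (t *\<^sub>R v)"
      using assms(6) near[of "s + t *\<^sub>R v"] near_s
      by (force simp: hessian_Lipschitz_def)
  qed
  have step: "norm (v - \<eta> *\<^sub>R (H *v v)) \<le> (1 + \<eta> / 2 * deviation_rate f P x) * norm v"
  proof (cases "v = 0")
    case False
    define r where "r = deviation_rate f P x"
    have "inner v (psd_part H *v v) + 3 * inner v (nsd_part H *v v) = - r * (norm v)\<^sup>2"
      using False
      by (simp add: r_def deviation_rate_def deviation_minus_def deviation_plus_def
          v_def[symmetric] s_def[symmetric] H_def[symmetric] algebra_simps)
    then have sq: "(norm (v - \<eta> *\<^sub>R (H *v v)))\<^sup>2 \<le> (1 + \<eta> * r) * (norm v)\<^sup>2"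
      using norm_gradient_step_le[OF transpose_hessian[OF assms(1)] bound[unfolded H_def], of \<eta> v]
        assms(9) \<open>\<eta> * L \<le> 1\<close>
      by (simp add: H_def algebra_simps)
    \<comment> \<open>The right-hand side dominates a square, so \<open>\<eta> * r \<ge> -1\<close>.
      This gives the sign needed for taking the square root.\<close>
    then have "0 \<le> (1 + \<eta> * r) * (norm v)\<^sup>2"
      by (meson order_trans zero_le_power2)
    then have "0 \<le> 1 + \<eta> * r"
      using False by (simp add: zero_le_mult_iff)
    then have nonneg: "0 \<le> 1 + \<eta> / 2 * r"
      by simp
    \<comment> \<open>Completing the square adds \<open>(\<eta> / 2 * r)\<^sup>2\<close>.\<close>
    have "1 + \<eta> * r \<le> (1 + \<eta> / 2 * r)\<^sup>2"
      by (simp add: power2_sum power_mult_distrib)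
    then have "(1 + \<eta> * r) * (norm v)\<^sup>2 \<le> ((1 + \<eta> / 2 * r) * norm v)\<^sup>2"
      unfolding power_mult_distrib by (rule mult_right_mono) simp
    with sq have "(norm (v - \<eta> *\<^sub>R (H *v v)))\<^sup>2 \<le> ((1 + \<eta> / 2 * r) * norm v)\<^sup>2"
      by (rule order_trans)
    then show ?thesis
      unfolding r_def[symmetric]
      by (rule power2_le_imp_le) (intro mult_nonneg_nonneg nonneg norm_ge_zero)
  qed simp
  \<comment> \<open>The updated \<open>s\<close> lies in \<open>M\<close> by closure under gradient
    steps, so it competes with the nearest point of the updated \<open>x\<close>.\<close>
  have "norm (perp P (x - \<eta> *\<^sub>R gradient f x)) \<le>
      norm ((x - \<eta> *\<^sub>R gradient f x) - (s - \<eta> *\<^sub>R gradient f s))"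
    using assms(7,9) \<open>s \<in> M\<close> by (intro P) auto
  also have "\<dots> = norm ((v - \<eta> *\<^sub>R (H *v v)) - \<eta> *\<^sub>R (gradient f x - gradient f s - H *v v))"
    by (simp add: x algebra_simps)
  also have "\<dots> \<le> norm (v - \<eta> *\<^sub>R (H *v v)) + \<eta> * norm (gradient f x - gradient f s - H *v v)"
    using norm_triangle_ineq4[of "v - \<eta> *\<^sub>R (H *v v)" "\<eta> *\<^sub>R (gradient f x - gradient f s - H *v v)"]
      assms(9) by simp
  also have "\<dots> \<le> (1 + \<eta> / 2 * deviation_rate f P x) * norm v + \<eta> * (\<rho> / 2 * (norm v)\<^sup>2)"
    using step taylor assms(9) by (intro add_mono mult_left_mono) auto
  finally show ?thesis
    by (simp add: v_def power2_eq_square algebra_simps)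
qed

end
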